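(* There exist sub-self-affine sets whose box dimension does not exist. That is, there exist a dimension $d\ge 1$, an affine iterated function system $\{S_i:\mathbb{R}^d\to\mathbb{R}^d\}_{i=1}^N$, and a sub-self-affine set $E\subset\mathbb{R}^d$ for this system, such that $\underline{\dim}_{\mathrm{B}} E<\overline{\dim}_{\mathrm{B}} E$.
   Context: An affine iterated function system on $\mathbb{R}^d$ is a finite collection $\{S_i:\mathbb{R}^d\to\mathbb{R}^d\}_{i=1}^N$ of affine contractions, i.e. $S_i(x)=A_i x+\mathbf{t}_i$ where $A_i\in GL(d,\mathbb{R})$ has Euclidean (operator) norm $\|A_i\|<1$ and $\mathbf{t}_i\in\mathbb{R}^d$. A sub-self-affine set for $\{S_i\}_{i=1}^N$ is a non-empty compact set $E\subset\mathbb{R}^d$ such that $$E\subseteq\bigcup_{i=1}^N S_i(E).$$ For $E\subset\mathbb{R}^d$, the lower and upper box dimensions are $$\underline{\dim}_{\mathrm{B}} E=\liminf_{\delta\to 0}\frac{\log N_\delta(E)}{-\log\delta},\qquad \overline{\dim}_{\mathrm{B}} E=\limsup_{\delta\to 0}\frac{\log N_\delta(E)}{-\log\delta},$$ where $N_\delta(E)$ is the smallest number of sets of diameter $\delta>0$ required to cover $E$. If they coincide, the common value is the box dimension of $E$; otherwise the box dimension of $E$ does not exist. *)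

theory Defs
  imports
    "HOL-Analysis.Analysis"
    "Jordan_Normal_Form.Matrix"
begin

text \<open>
  The dimension \<open>d\<close> is quantified inside the statements, so the Euclidean space of dimension \<open>d\<close>
  is the carrier \<^term>\<open>carrier_vec d :: real vec set\<close>. Norm and distance take the dimension as a
  parameter; they are only meant for arguments from this carrier.
\<close>

definition eucl_norm :: "nat \<Rightarrow> real vec \<Rightarrow> real" where
  "eucl_norm d x = L2_set (\<lambda>i. vec_index x i) {..<d}"

definition eucl_dist :: "nat \<Rightarrow> real vec \<Rightarrow> real vec \<Rightarrow> real" where
  "eucl_dist d x y = L2_set (\<lambda>i. vec_index x i - vec_index y i) {..<d}"

lemma eucl_dist_eq_norm:
  assumes "x \<in> carrier_vec d" "y \<in> carrier_vec d"
  shows "eucl_dist d x y = eucl_norm d (x - y)"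
  using assms unfolding eucl_dist_def eucl_norm_def by (intro L2_set_cong) auto

lemma Metric_space_eucl: "Metric_space (carrier_vec d) (eucl_dist d)"
proof
  fix x y z :: "real vec"
  show "0 \<le> eucl_dist d x y"
    by (simp add: eucl_dist_def)
  show "eucl_dist d x y = eucl_dist d y x"
    by (simp add: eucl_dist_def L2_set_def power2_commute)
  assume xy: "x \<in> carrier_vec d" "y \<in> carrier_vec d"
  show "eucl_dist d x y = 0 \<longleftrightarrow> x = y"
  proof
    assume "eucl_dist d x y = 0"
    then have "\<forall>i<d. vec_index x i = vec_index y i"
      by (auto simp: eucl_dist_def L2_set_eq_0_iff)
    with xy show "x = y" by (intro eq_vecI) auto
  qed (simp add: eucl_dist_def L2_set_eq_0_iff)
  have "eucl_dist d x z
      = L2_set (\<lambda>i. (vec_index x i - vec_index y i) + (vec_index y i - vec_index z i)) {..<d}"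
    by (simp add: eucl_dist_def)
  also have "\<dots> \<le> eucl_dist d x y + eucl_dist d y z"
    unfolding eucl_dist_def by (rule L2_set_triangle_ineq)
  finally show "eucl_dist d x z \<le> eucl_dist d x y + eucl_dist d y z" .
qed

definition eucl_topology :: "nat \<Rightarrow> real vec topology" where
  "eucl_topology d = Metric_space.mtopology (carrier_vec d) (eucl_dist d)"

text \<open>The operator norm, by the same formula as \<^const>\<open>onorm\<close>.\<close>

definition op_norm :: "nat \<Rightarrow> real mat \<Rightarrow> real" where
  "op_norm d A = (SUP x\<in>carrier_vec d. eucl_norm d (A *\<^sub>v x) / eucl_norm d x)"

definition affine_contraction :: "nat \<Rightarrow> (real vec \<Rightarrow> real vec) \<Rightarrow> bool" where
  "affine_contraction d S \<longleftrightarrow>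
     (\<exists>A\<in>carrier_mat d d. \<exists>t\<in>carrier_vec d.
        invertible_mat A \<and> op_norm d A < 1 \<and> (\<forall>x\<in>carrier_vec d. S x = A *\<^sub>v x + t))"

definition affine_IFS :: "nat \<Rightarrow> nat \<Rightarrow> (nat \<Rightarrow> real vec \<Rightarrow> real vec) \<Rightarrow> bool" where
  "affine_IFS d N S \<longleftrightarrow> 1 \<le> N \<and> (\<forall>i\<in>{1..N}. affine_contraction d (S i))"

definition sub_self_affine_set ::
  "nat \<Rightarrow> nat \<Rightarrow> (nat \<Rightarrow> real vec \<Rightarrow> real vec) \<Rightarrow> real vec set \<Rightarrow> bool" where
  "sub_self_affine_set d N S E \<longleftrightarrow>
     E \<noteq> {} \<and> compactin (eucl_topology d) E \<and> E \<subseteq> (\<Union>i\<in>{1..N}. S i ` E)"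

text \<open>
  The diameter is taken in \<^typ>\<open>ennreal\<close>, where the supremum is meaningful also for unbounded sets.
\<close>

definition eucl_diameter :: "nat \<Rightarrow> real vec set \<Rightarrow> ennreal" where
  "eucl_diameter d U = (SUP (x, y)\<in>U \<times> U. ennreal (eucl_dist d x y))"

text \<open>
  The covering sets have diameter exactly \<open>\<delta>\<close> and need not be contained in \<open>E\<close>. The infimum
  below is the minimum whenever \<open>\<delta> > 0\<close>, \<open>d \<ge> 1\<close> and \<open>E\<close> is bounded; an unbounded \<open>E\<close> has no finite cover and
  gets the junk value 0.
\<close>

definition covering_number :: "nat \<Rightarrow> real \<Rightarrow> real vec set \<Rightarrow> nat" where
  "covering_number d \<delta> E =
     Inf {card \<C> | \<C>. finite \<C> \<and> E \<subseteq> \<Union>\<C> \<and>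
                      (\<forall>U\<in>\<C>. U \<subseteq> carrier_vec d \<and> eucl_diameter d U = ennreal \<delta>)}"

definition lower_box_dim :: "nat \<Rightarrow> real vec set \<Rightarrow> ereal" where
  "lower_box_dim d E =
     Liminf (at_right 0) (\<lambda>\<delta>. ereal (ln (real (covering_number d \<delta> E)) / - ln \<delta>))"

definition upper_box_dim :: "nat \<Rightarrow> real vec set \<Rightarrow> ereal" where
  "upper_box_dim d E =
     Limsup (at_right 0) (\<lambda>\<delta>. ereal (ln (real (covering_number d \<delta> E)) / - ln \<delta>))"

end

theory Submission
  imports Defs
begin

text \<open>
  The example lives in the unit square of the plane, under the eight maps
  \<open>(x, y) \<mapsto> ((x + p) / 2, (y + q) / 4)\<close> with \<open>p < 2\<close> and \<open>q < 4\<close>. It is the closure of a comb: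
  the base \<open>[0, 1] \<times> {0}\<close> together with, for every \<open>k\<close> and every \<open>i \<le> 2 * 16 ^ k\<close>, horizontal teeth
  of length \<open>2 ^ -(i + 16 ^ k)\<close> at the \<open>4 ^ i\<close> heights \<open>j / 4 ^ i < 1\<close>. The inverse of a suitable map
  carries a tooth of the family \<open>(k, i + 1)\<close> to a tooth of the family \<open>(k, i)\<close>, and a tooth of the
  family \<open>(k, 0)\<close> lies in the base, which is covered by its own two halves. So the comb is contained
  in the union of its images, and this passes to the closure.

  On the scale \<open>4 ^ -n\<close>, a tooth of length \<open>2 ^ -l\<close> with \<open>l \<le> 2 * n\<close> needs about \<open>2 ^ (2 * n - l)\<close>
  squares. As long as \<open>i \<le> n\<close>, teeth at different heights lie in different rows of squares, so the
  family \<open>(k, i)\<close> needs about \<open>2 ^ (2 * n + (i - 16 ^ k))\<close> squares: the gain over the exponent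
  \<open>2 * n\<close> is \<open>i - 16 ^ k\<close>. The size of this gain relative to \<open>n\<close> oscillates.

  \<^item> For \<open>n = 2 * 16 ^ k\<close> the family \<open>(k, n)\<close> has gain \<open>n / 2\<close>, which gives an upper box dimension
    of at least \<open>5 / 4\<close>.
  \<^item> For \<open>n = 16 ^ (k + 1)\<close> the families that belong to larger indices than \<open>k\<close> have no gain, because
    \<open>i - 16 ^ k' \<le> i - n \<le> 0\<close> if \<open>k' > k\<close> and \<open>i \<le> n\<close>, while for \<open>i > n\<close> the teeth are shorter than
    one square and \<open>4 ^ n\<close> squares cover all of them. The other families have a gain of at most
    \<open>16 ^ k = n / 16\<close>. This gives a lower box dimension of at most \<open>33 / 32\<close>.

  The counts are carried out in \<open>covering_number_comb_ge\<close> and \<open>covering_number_comb_le\<close>. The constants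
  \<open>6 / 5\<close> and \<open>9 / 8\<close> used for the dimensions are weaker than \<open>5 / 4\<close> and \<open>33 / 32\<close>; the slack
  absorbs bounded factors and the number of families, so that no limit has to be computed.
\<close>

section \<open>The plane as a carrier of vectors\<close>

definition plane_vec :: "real \<times> real \<Rightarrow> real vec" where
  "plane_vec = (\<lambda>(x, y). vec 2 (\<lambda>i. if i = 0 then x else y))"

lemma plane_vec_carrier [simp]: "plane_vec p \<in> carrier_vec 2"
  by (simp add: plane_vec_def split: prod.split)

lemma eucl_dist_plane_vec: "eucl_dist 2 (plane_vec p) (plane_vec q) = dist p q"
  by (cases p; cases q)
    (simp add: plane_vec_def eucl_dist_def L2_set_def dist_Pair_Pair dist_real_def
       numeral_2_eq_2)

lemma continuous_map_plane_vec: "continuous_map euclidean (eucl_topology 2) plane_vec"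
proof -
  interpret Metric_space "carrier_vec 2" "eucl_dist 2" by (rule Metric_space_eucl)
  show ?thesis
    unfolding eucl_topology_def continuous_map_to_metric
  proof (intro ballI allI impI)
    fix p :: "real \<times> real" and e :: real
    assume "0 < e"
    then show "\<exists>U. openin euclidean U \<and> p \<in> U \<and> (\<forall>q\<in>U. plane_vec q \<in> mball (plane_vec p) e)"
      by (intro exI[of _ "ball p e"]) (simp add: in_mball eucl_dist_plane_vec)
  qed
qed

lemma compactin_plane_vec: "compact K \<Longrightarrow> compactin (eucl_topology 2) (plane_vec ` K)"
  by (rule image_compactin[OF _ continuous_map_plane_vec]) simp

section \<open>Covering numbers\<close>

lemma covering_number_le_card:
  assumes "finite \<C>" "E \<subseteq> \<Union>\<C>"
    "\<forall>U\<in>\<C>. U \<subseteq> carrier_vec d \<and> eucl_diameter d U = ennreal \<delta>"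
  shows "covering_number d \<delta> E \<le> card \<C>"
  unfolding covering_number_def by (rule cInf_lower) (use assms in auto)

lemma eucl_dist_le_diameter:
  assumes "x \<in> U" "y \<in> U" "eucl_diameter d U = ennreal \<delta>" "0 \<le> \<delta>"
  shows "eucl_dist d x y \<le> \<delta>"
proof -
  have "ennreal (eucl_dist d x y) \<le> eucl_diameter d U"
    unfolding eucl_diameter_def by (rule SUP_upper2[of "(x, y)"]) (use assms in auto)
  then show ?thesis using assms by simp
qed

text \<open>
  A set of diameter \<open>\<delta>\<close> contains at most one point of a set whose points are more than \<open>\<delta>\<close> apart.
  The assumed cover \<open>\<C>\<close> only rules out that the infimum is taken over the empty set, where it would
  be \<open>0\<close>.
\<close>

lemma card_separated_le_covering_number:
  assumes P: "finite P" "P \<subseteq> E" "0 \<le> \<delta>"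
    and sep: "\<And>x y. x \<in> P \<Longrightarrow> y \<in> P \<Longrightarrow> x \<noteq> y \<Longrightarrow> \<delta> < eucl_dist d x y"
    and cover: "finite \<C>" "E \<subseteq> \<Union>\<C>"
      "\<forall>U\<in>\<C>. U \<subseteq> carrier_vec d \<and> eucl_diameter d U = ennreal \<delta>"
  shows "card P \<le> covering_number d \<delta> E"
  unfolding covering_number_def
proof (rule cInf_greatest)
  fix c assume "c \<in> {card \<C> |\<C>. finite \<C> \<and> E \<subseteq> \<Union>\<C> \<and>
     (\<forall>U\<in>\<C>. U \<subseteq> carrier_vec d \<and> eucl_diameter d U = ennreal \<delta>)}"
  then obtain \<D> where D: "c = card \<D>" "finite \<D>" "E \<subseteq> \<Union>\<D>"
    "\<forall>U\<in>\<D>. eucl_diameter d U = ennreal \<delta>" by auto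
  have "\<forall>x\<in>P. \<exists>U\<in>\<D>. x \<in> U" using P D by blast
  then obtain f where f: "\<And>x. x \<in> P \<Longrightarrow> f x \<in> \<D> \<and> x \<in> f x" by metis
  have "inj_on f P"
  proof (rule inj_onI, rule ccontr)
    fix x y assume xy: "x \<in> P" "y \<in> P" "f x = f y" "x \<noteq> y"
    then have "eucl_dist d x y \<le> \<delta>"
      using f[of x] f[of y] D(4) P(3) by (intro eucl_dist_le_diameter[of _ "f x"]) auto
    with sep xy show False by fastforce
  qed
  then show "card P \<le> c" using D f by (auto intro!: card_inj_on_le)
qed (use cover in blast)

definition grid_square :: "real \<Rightarrow> nat \<times> nat \<Rightarrow> (real \<times> real) set" where
  "grid_square s = (\<lambda>(a, b). {real a * s..(real a + 1) * s} \<times> {real b * s..(real b + 1) * s})"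

lemma diameter_grid_square:
  assumes "0 \<le> s"
  shows "eucl_diameter 2 (plane_vec ` grid_square s ab) = ennreal (sqrt 2 * s)"
proof (rule antisym)
  obtain a b where ab: "ab = (a, b)" by fastforce
  have d: "dist p q \<le> sqrt 2 * s" if "p \<in> grid_square s ab" "q \<in> grid_square s ab" for p q
  proof -
    obtain x y u v where pq: "p = (x, y)" "q = (u, v)" by fastforce
    have "\<bar>x - u\<bar> \<le> s" "\<bar>y - v\<bar> \<le> s"
      using that by (auto simp: grid_square_def ab pq algebra_simps)
    then have "(x - u)\<^sup>2 \<le> s\<^sup>2" "(y - v)\<^sup>2 \<le> s\<^sup>2"
      by (simp_all add: abs_le_square_iff[symmetric] assms)
    then have "sqrt ((x - u)\<^sup>2 + (y - v)\<^sup>2) \<le> sqrt (2 * s\<^sup>2)" by simp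
    then show ?thesis using assms by (simp add: pq dist_Pair_Pair dist_real_def real_sqrt_mult)
  qed
  then show "eucl_diameter 2 (plane_vec ` grid_square s ab) \<le> ennreal (sqrt 2 * s)"
    unfolding eucl_diameter_def
    by (intro SUP_least) (auto simp: eucl_dist_plane_vec intro!: ennreal_leI)
  let ?p = "(real a * s, real b * s)" and ?q = "((real a + 1) * s, (real b + 1) * s)"
  have "dist ?p ?q = sqrt (2 * s\<^sup>2)"
    by (simp add: dist_Pair_Pair dist_real_def algebra_simps power2_eq_square)
  also have "\<dots> = sqrt 2 * s" using assms by (simp add: real_sqrt_mult)
  finally have "eucl_dist 2 (plane_vec ?p) (plane_vec ?q) = sqrt 2 * s"
    by (simp add: eucl_dist_plane_vec)
  moreover have "?p \<in> grid_square s ab" "?q \<in> grid_square s ab"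
    using assms by (auto simp: grid_square_def ab algebra_simps)
  ultimately show "ennreal (sqrt 2 * s) \<le> eucl_diameter 2 (plane_vec ` grid_square s ab)"
    unfolding eucl_diameter_def
    by (intro SUP_upper2[of "(plane_vec ?p, plane_vec ?q)"]) auto
qed

text \<open>
  The squares are closed, so finitely many of them that cover \<open>K\<close> also cover its closure. Hence the
  limit points of the comb never enter the counts.
\<close>

lemma grid_square_cover:
  assumes "finite B" "0 \<le> s" "K \<subseteq> (\<Union>ab\<in>B. grid_square s ab)"
  defines "\<C> \<equiv> (\<lambda>ab. plane_vec ` grid_square s ab) ` B"
  shows "finite \<C>" "plane_vec ` closure K \<subseteq> \<Union>\<C>"
    "\<forall>U\<in>\<C>. U \<subseteq> carrier_vec 2 \<and> eucl_diameter 2 U = ennreal (sqrt 2 * s)"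
    "card \<C> \<le> card B"
proof -
  have "closed (grid_square s ab)" for ab
    by (cases ab) (simp add: grid_square_def closed_Times)
  then have "closure K \<subseteq> (\<Union>ab\<in>B. grid_square s ab)"
    using assms by (intro closure_minimal closed_UN) auto
  then show "plane_vec ` closure K \<subseteq> \<Union>\<C>" unfolding \<C>_def by blast
qed (use assms in \<open>auto simp: \<C>_def diameter_grid_square card_image_le\<close>)

lemma grid_cell:
  assumes "0 \<le> x" "0 < s"
  obtains a :: nat where "real a \<le> x / s" "x \<in> {real a * s..(real a + 1) * s}"
proof
  let ?a = "nat \<lfloor>x / s\<rfloor>"
  have *: "real ?a \<le> x / s" "x / s \<le> real ?a + 1"
    using assms floor_correct[of "x / s"] by (simp_all add: of_nat_nat)
  then show "real ?a \<le> x / s" by simp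
  show "x \<in> {real ?a * s..(real ?a + 1) * s}"
    using * assms(2) by (simp add: pos_le_divide_eq pos_divide_le_eq)
qed

section \<open>The comb\<close>

definition levels :: "nat \<Rightarrow> real set" where
  "levels i = (\<lambda>j. real j / 4 ^ i) ` {..<4 ^ i}"

definition comb :: "(real \<times> real) set" where
  "comb = {0..1} \<times> {0} \<union>
     (\<Union>k. \<Union>i\<in>{..2 * 16 ^ k}. {0..1 / 2 ^ (i + 16 ^ k)} \<times> levels i)"

lemma levels_bounds: "y \<in> levels i \<Longrightarrow> 0 \<le> y \<and> y < 1"
proof -
  assume "y \<in> levels i"
  then obtain j where j: "y = real j / 4 ^ i" "j < 4 ^ i" by (auto simp: levels_def)
  then have "real j < 4 ^ i" by (metis of_nat_less_iff of_nat_numeral of_nat_power)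
  then show ?thesis using j by simp
qed

lemma comb_in_square: "comb \<subseteq> {0..1} \<times> {0..1}"
proof -
  have "{0..1 / 2 ^ m} \<times> levels i \<subseteq> {0..1::real} \<times> {0..1}" for m i
  proof (rule Sigma_mono)
    have "(1::real) / 2 ^ m \<le> 1" by simp
    then show "{0..1 / 2 ^ m} \<subseteq> {0..1::real}" by (intro atLeastatMost_subset_iff[THEN iffD2]) simp
    show "levels i \<subseteq> {0..1}" by (auto dest: levels_bounds)
  qed
  then show ?thesis
    unfolding comb_def by (intro Un_least UN_least) (force, blast)
qed

definition digit_map :: "nat \<Rightarrow> nat \<Rightarrow> real \<times> real \<Rightarrow> real \<times> real" where
  "digit_map p q = (\<lambda>(x, y). ((x + real p) / 2, (y + real q) / 4))"

text \<open>The digit \<open>q\<close> is the leading digit of \<open>y\<close> to base 4, and \<open>y'\<close> is what remains after it.\<close>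

lemma levels_Suc:
  assumes "y \<in> levels (Suc i)"
  obtains q y' where "q < 4" "y' \<in> levels i" "y = (y' + real q) / 4"
proof -
  obtain j where j: "y = real j / 4 ^ Suc i" "j < 4 ^ Suc i"
    using assms by (auto simp: levels_def)
  define q r where "q = j div 4 ^ i" and "r = j mod 4 ^ i"
  have "j = q * 4 ^ i + r" unfolding q_def r_def by (rule div_mult_mod_eq[symmetric])
  then have "real j = real q * 4 ^ i + real r" by simp
  then have "y = (real r / 4 ^ i + real q) / 4" by (simp add: j(1) field_simps)
  moreover have "q < 4" using j by (simp add: q_def less_mult_imp_div_less)
  moreover have "real r / 4 ^ i \<in> levels i" by (auto simp: levels_def r_def)
  ultimately show ?thesis using that by blast
qed

text \<open>
  Zooming in by the inverse maps doubles the length of a tooth and lowers \<open>i\<close> by one for the same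
  \<open>k\<close>. This is why the family \<open>(k, 2 * 16 ^ k)\<close>, which makes the covering number large on its scale,
  has to be accompanied by all \<open>(k, i)\<close> with smaller \<open>i\<close>.
\<close>

lemma comb_subset_digit_maps: "comb \<subseteq> (\<Union>p<2. \<Union>q<4. digit_map p q ` comb)"
proof
  fix z assume z: "z \<in> comb"
  obtain x y where xy: "z = (x, y)" by fastforce
  have image: "z \<in> (\<Union>p<2. \<Union>q<4. digit_map p q ` comb)"
    if "p < 2" "q < 4" "(u, v) \<in> comb" "x = (u + real p) / 2" "y = (v + real q) / 4" for p q u v
  proof -
    have "z = digit_map p q (u, v)" using that by (simp add: digit_map_def xy)
    with that(1-3) show ?thesis by blast
  qed
  have base: "z \<in> (\<Union>p<2. \<Union>q<4. digit_map p q ` comb)" if "0 \<le> x" "x \<le> 1" "y = 0"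
  proof (cases "x \<le> 1 / 2")
    case True
    show ?thesis
      by (rule image[of 0 0 "2 * x" 0]) (use that True in \<open>auto simp: comb_def\<close>)
  next
    case False
    show ?thesis
      by (rule image[of 1 0 "2 * x - 1" 0]) (use that False in \<open>auto simp: comb_def\<close>)
  qed
  from z consider "0 \<le> x" "x \<le> 1" "y = 0"
    | k i where "i \<le> 2 * 16 ^ k" "0 \<le> x" "x \<le> 1 / 2 ^ (i + 16 ^ k)" "y \<in> levels i"
    unfolding comb_def xy by auto
  then show "z \<in> (\<Union>p<2. \<Union>q<4. digit_map p q ` comb)"
  proof cases
    case 1
    then show ?thesis by (rule base)
  next
    case (2 k i)
    show ?thesis
    proof (cases i)
      case 0
      with 2 have "y = 0" by (auto simp: levels_def)
      moreover have "x \<le> 1" using z comb_in_square by (auto simp: xy)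
      ultimately show ?thesis using 2 by (intro base)
    next
      case (Suc i')
      with 2 obtain q y' where q: "q < 4" "y' \<in> levels i'" "y = (y' + real q) / 4"
        by (metis levels_Suc)
      have "2 * x \<le> 1 / 2 ^ (i' + 16 ^ k)"
        using 2(3) by (simp add: Suc field_simps)
      then have "(2 * x, y') \<in> {0..1 / 2 ^ (i' + 16 ^ k)} \<times> levels i'"
        using 2 q by simp
      moreover have "i' \<in> {..2 * 16 ^ k}" using 2(1) Suc by simp
      ultimately have "(2 * x, y') \<in> comb" unfolding comb_def by blast
      then show ?thesis using q by (intro image[of 0 q "2 * x" y']) auto
    qed
  qed
qed

lemma compact_closure_comb: "compact (closure comb)"
  using bounded_subset[OF _ comb_in_square]
  by (simp add: compact_closure bounded_Times)

lemma closure_comb_subset_digit_maps: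
  "closure comb \<subseteq> (\<Union>p<2. \<Union>q<4. digit_map p q ` closure comb)"
proof (rule closure_minimal)
  show "comb \<subseteq> (\<Union>p<2. \<Union>q<4. digit_map p q ` closure comb)"
    by (rule order_trans[OF comb_subset_digit_maps])
      (intro UN_mono image_mono closure_subset subset_refl)
  have "continuous_on (closure comb) (digit_map p q)" for p q
    unfolding digit_map_def case_prod_unfold by (intro continuous_intros) auto
  then have "closed (digit_map p q ` closure comb)" for p q
    by (intro compact_imp_closed compact_continuous_image compact_closure_comb)
  then show "closed (\<Union>p<2. \<Union>q<4. digit_map p q ` closure comb)"
    by (intro closed_UN ballI) auto
qed

section \<open>The affine maps\<close>

definition contraction_mat :: "real mat" where
  "contraction_mat = mat 2 2 (\<lambda>(i, j). if i = j then if i = 0 then 1 / 2 else 1 / 4 else 0)"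

definition affine_digit_map :: "nat \<Rightarrow> nat \<Rightarrow> real vec \<Rightarrow> real vec" where
  "affine_digit_map p q v = contraction_mat *\<^sub>v v + plane_vec (real p / 2, real q / 4)"

lemma contraction_mat_mult_vec:
  assumes "v \<in> carrier_vec 2"
  shows "contraction_mat *\<^sub>v v = vec 2 (\<lambda>i. (if i = 0 then 1 / 2 else 1 / 4) * vec_index v i)"
  using assms
  by (intro eq_vecI)
    (auto simp: contraction_mat_def scalar_prod_def numeral_2_eq_2 less_Suc_eq)

lemma affine_digit_map_plane_vec:
  "affine_digit_map p q (plane_vec z) = plane_vec (digit_map p q z)"
proof -
  obtain x y where "z = (x, y)" by fastforce
  then show ?thesis
    by (intro eq_vecI)
      (auto simp: affine_digit_map_def contraction_mat_mult_vec digit_map_def plane_vec_def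
        add_divide_distrib)
qed

lemma op_norm_contraction_mat: "op_norm 2 contraction_mat \<le> 1 / 2"
  unfolding op_norm_def
proof (rule cSUP_least)
  show "carrier_vec 2 \<noteq> ({} :: real vec set)" using plane_vec_carrier by blast
  fix v :: "real vec" assume v: "v \<in> carrier_vec 2"
  have "eucl_norm 2 (contraction_mat *\<^sub>v v)
      \<le> sqrt (\<Sum>i<2. (1 / 2 * vec_index v i)\<^sup>2)"
    unfolding eucl_norm_def L2_set_def
  proof (intro real_sqrt_le_mono sum_mono)
    fix i :: nat assume "i \<in> {..<2}"
    then show "(vec_index (contraction_mat *\<^sub>v v) i)\<^sup>2 \<le> (1 / 2 * vec_index v i)\<^sup>2"
      by (simp add: contraction_mat_mult_vec[OF v] power_mult_distrib power2_eq_square)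
  qed
  also have "\<dots> = 1 / 2 * eucl_norm 2 v"
    unfolding eucl_norm_def L2_set_def
    by (simp only: power_mult_distrib sum_distrib_left[symmetric] real_sqrt_mult) simp
  finally have "eucl_norm 2 (contraction_mat *\<^sub>v v) \<le> 1 / 2 * eucl_norm 2 v" .
  moreover have "0 \<le> eucl_norm 2 v" by (simp add: eucl_norm_def)
  ultimately show "eucl_norm 2 (contraction_mat *\<^sub>v v) / eucl_norm 2 v \<le> 1 / 2"
    by (cases "eucl_norm 2 v = 0") (auto simp: divide_simps)
qed

lemma invertible_contraction_mat: "invertible_mat contraction_mat"
proof -
  define B :: "real mat" where
    "B = mat 2 2 (\<lambda>(i, j). if i = j then if i = 0 then 2 else 4 else 0)"
  have "contraction_mat * B = 1\<^sub>m 2" "B * contraction_mat = 1\<^sub>m 2"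
    by (rule eq_matI;
        auto simp: contraction_mat_def B_def scalar_prod_def numeral_2_eq_2 less_Suc_eq)+
  then show ?thesis
    unfolding invertible_mat_def inverts_mat_def square_mat.simps
    by (auto simp: contraction_mat_def B_def intro!: exI[of _ B])
qed

lemma affine_contraction_digit_map: "affine_contraction 2 (affine_digit_map p q)"
  unfolding affine_contraction_def
proof (intro bexI conjI)
  show "contraction_mat \<in> carrier_mat 2 2" by (simp add: contraction_mat_def)
  show "plane_vec (real p / 2, real q / 4) \<in> carrier_vec 2" by simp
  show "op_norm 2 contraction_mat < 1" using op_norm_contraction_mat by simp
qed (simp_all add: invertible_contraction_mat affine_digit_map_def)

definition digit_IFS :: "nat \<Rightarrow> real vec \<Rightarrow> real vec" where
  "digit_IFS i = affine_digit_map ((i - 1) div 4) ((i - 1) mod 4)"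

lemma sub_self_affine_comb: "sub_self_affine_set 2 8 digit_IFS (plane_vec ` closure comb)"
  unfolding sub_self_affine_set_def
proof (intro conjI)
  have "(0, 0) \<in> comb" by (simp add: comb_def)
  then show "plane_vec ` closure comb \<noteq> {}" using closure_subset by blast
  show "compactin (eucl_topology 2) (plane_vec ` closure comb)"
    by (intro compactin_plane_vec compact_closure_comb)
  show "plane_vec ` closure comb \<subseteq> (\<Union>i\<in>{1..8}. digit_IFS i ` plane_vec ` closure comb)"
  proof
    fix v assume "v \<in> plane_vec ` closure comb"
    then obtain p q z where pq: "p < 2" "q < 4" "z \<in> closure comb"
      "v = plane_vec (digit_map p q z)"
      using closure_comb_subset_digit_maps by (auto dest!: subsetD)
    then have "v = digit_IFS (4 * p + q + 1) (plane_vec z)"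
      by (simp add: digit_IFS_def affine_digit_map_plane_vec)
    moreover have "4 * p + q + 1 \<in> {1..8}" using pq by simp
    ultimately show "v \<in> (\<Union>i\<in>{1..8}. digit_IFS i ` plane_vec ` closure comb)"
      using pq by blast
  qed
qed

section \<open>Covering numbers of the comb on two sequences of scales\<close>

lemma le_2_power: "m \<le> (2::nat) ^ m"
  by (simp add: less_imp_le less_exp)

text \<open>
  On the scale \<open>4 ^ -n\<close> with \<open>n = 16 ^ (k + 1)\<close>, every family \<open>(k', i)\<close> with \<open>i \<le> n\<close> satisfies
  \<open>i \<le> 16 ^ k + 16 ^ k'\<close>: for \<open>k' \<le> k\<close> because \<open>i \<le> 2 * 16 ^ k'\<close>, for \<open>k' > k\<close> because
  \<open>n \<le> 16 ^ k'\<close>. This bounds the length of its teeth by \<open>2 ^ (16 ^ k - 2 * i)\<close>, whatever \<open>k'\<close> is,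
  so that the infinitely many families with the same \<open>i\<close> share one set of squares. The families with
  \<open>i > n\<close> have teeth shorter than one square and stay in the first column of the grid.
\<close>

lemma covering_number_comb_le:
  defines "m k \<equiv> (16::nat) ^ k"
  shows "covering_number 2 (sqrt 2 / 4 ^ (16 * m k)) (plane_vec ` closure comb)
    \<le> 2 ^ (34 * m k + 6)"
proof -
  define n where "n = 16 * m k"
  define s :: real where "s = 1 / 4 ^ n"
  have s: "0 < s" "0 \<le> s" by (simp_all add: s_def)
  \<comment> \<open>The squares that meet the teeth of the families \<open>(k', i)\<close>; their heights are multiples of \<open>s\<close>,
    hence the factor \<open>4 ^ (n - i)\<close>.\<close>
  define rows where "rows i =
    {..(2::nat) ^ (2 * n + m k - 2 * i)} \<times> (\<lambda>j. j * 4 ^ (n - i)) ` {..<(4::nat) ^ i}" for i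
  define B where "B = {0::nat} \<times> {..<(4::nat) ^ n} \<union> (\<Union>i\<le>n. rows i)"
  have mono: "m k' \<le> m k" if "k' \<le> k" for k' unfolding m_def using that by simp
  have big: "n \<le> m k'" if "k < k'" for k'
  proof -
    have "m (Suc k) \<le> m k'" unfolding m_def using that by (intro power_increasing) auto
    then show ?thesis by (simp add: n_def m_def)
  qed
  have row: "(x, real j / 4 ^ i) \<in> (\<Union>ab\<in>B. grid_square s ab)"
    if i: "i \<le> n" and j: "j < 4 ^ i" and x: "0 \<le> x" "x * 4 ^ n \<le> 2 ^ (2 * n + m k - 2 * i)"
    for x i j
  proof -
    obtain a :: nat where a: "real a \<le> x / s" "x \<in> {real a * s..(real a + 1) * s}"
      using grid_cell x s by metis
    have "x / s = x * 4 ^ n" by (simp add: s_def)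
    then have "real a \<le> 2 ^ (2 * n + m k - 2 * i)" using a(1) x(2) by linarith
    then have "a \<le> 2 ^ (2 * n + m k - 2 * i)"
      by (metis of_nat_le_iff of_nat_numeral of_nat_power)
    then have "(a, j * 4 ^ (n - i)) \<in> rows i" using j by (auto simp: rows_def)
    then have "(a, j * 4 ^ (n - i)) \<in> B" using i by (auto simp: B_def)
    moreover have "(4::real) ^ n = 4 ^ (n - i) * 4 ^ i"
      using i by (simp flip: power_add)
    then have "real (j * 4 ^ (n - i)) * s = real j / 4 ^ i"
      by (simp add: s_def)
    then have "(x, real j / 4 ^ i) \<in> grid_square s (a, j * 4 ^ (n - i))"
      using a s by (simp add: grid_square_def distrib_right)
    ultimately show ?thesis by blast
  qed
  have "comb \<subseteq> (\<Union>ab\<in>B. grid_square s ab)"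
  proof
    fix z assume z: "z \<in> comb"
    obtain x y where xy: "z = (x, y)" by fastforce
    from z consider "0 \<le> x" "x \<le> 1" "y = 0"
      | k' i where "i \<le> 2 * m k'" "0 \<le> x" "x \<le> 1 / 2 ^ (i + m k')" "y \<in> levels i"
      unfolding comb_def xy m_def by auto
    then show "z \<in> (\<Union>ab\<in>B. grid_square s ab)"
    proof cases
      case 1
      have "x * 4 ^ n \<le> 1 * 4 ^ n" using 1 by (intro mult_right_mono) auto
      also have "\<dots> = 2 ^ (2 * n)" by (simp add: power_mult)
      also have "\<dots> \<le> 2 ^ (2 * n + m k - 2 * 0)" by (intro power_increasing) auto
      finally show ?thesis using row[of 0 0 x] 1 by (simp add: xy)
    next
      case (2 k' i)
      obtain j where j: "y = real j / 4 ^ i" "j < 4 ^ i" using 2 by (auto simp: levels_def)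
      \<comment> \<open>A bound on the number of columns that a tooth crosses.\<close>
      have x4: "x * 4 ^ n \<le> 2 ^ e" if "2 * n \<le> e + (i + m k')" for e
      proof -
        have "x * 4 ^ n \<le> 1 / 2 ^ (i + m k') * 4 ^ n" using 2 by (intro mult_right_mono) auto
        also have "\<dots> = 2 ^ (2 * n) / 2 ^ (i + m k')" by (simp add: power_mult)
        also have "\<dots> \<le> 2 ^ (e + (i + m k')) / 2 ^ (i + m k')"
          using that by (intro divide_right_mono power_increasing) auto
        also have "\<dots> = 2 ^ e" by (simp add: power_add)
        finally show ?thesis .
      qed
      show ?thesis
      proof (cases "i \<le> n")
        case True
        have "i \<le> m k + m k'"
        proof (cases "k' \<le> k")
          case True
          with 2(1) mono[OF True] show ?thesis by simp
        next
          case False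
          then show ?thesis using big[of k'] \<open>i \<le> n\<close> by simp
        qed
        then have "x * 4 ^ n \<le> 2 ^ (2 * n + m k - 2 * i)" using True by (intro x4) simp
        then show ?thesis unfolding xy j(1) using True j(2) 2(2) by (intro row)
      next
        case False
        have "k < k'"
        proof (rule ccontr)
          assume "\<not> k < k'"
          then show False using mono[of k'] 2(1) False by (simp add: n_def)
        qed
        then have "x * 4 ^ n \<le> 2 ^ 0" using big[of k'] False by (intro x4) simp
        then have xs: "x \<le> s" by (simp add: s_def field_simps)
        have y: "0 \<le> y" "y < 1" using levels_bounds 2(4) by auto
        then obtain b :: nat where b: "real b \<le> y / s" "y \<in> {real b * s..(real b + 1) * s}"
          using grid_cell s by metis
        have "y / s < 4 ^ n" using y by (simp add: s_def)
        with b have "real b < 4 ^ n" by linarith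
        then have "b < 4 ^ n" by (metis of_nat_less_iff of_nat_numeral of_nat_power)
        then have "(0, b) \<in> B" by (simp add: B_def)
        moreover have "z \<in> grid_square s (0, b)"
          using xs b 2(2) by (simp add: xy grid_square_def)
        ultimately show ?thesis by blast
      qed
    qed
  qed
  note cover = grid_square_cover[OF _ s(2) this]
  have "finite B" by (simp add: B_def rows_def)
  then have "covering_number 2 (sqrt 2 * s) (plane_vec ` closure comb) \<le> card B"
    using covering_number_le_card[OF cover(1-3)] cover(4) by (blast intro: order_trans)
  also have "card B \<le> 4 ^ n + (\<Sum>i\<le>n. card (rows i))"
  proof -
    have "card B \<le> card ({0::nat} \<times> {..<(4::nat) ^ n}) + card (\<Union>i\<le>n. rows i)"
      unfolding B_def by (rule card_Un_le)
    also have "card (\<Union>i\<le>n. rows i) \<le> (\<Sum>i\<le>n. card (rows i))" by (rule card_UN_le) simp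
    finally show ?thesis by (simp add: card_cartesian_product)
  qed
  also have "(\<Sum>i\<le>n. card (rows i)) \<le> (\<Sum>i\<le>n. 2 * 2 ^ (2 * n + m k))"
  proof (rule sum_mono)
    fix i assume "i \<in> {..n}"
    then have i: "2 * n + m k - 2 * i + 2 * i = 2 * n + m k" by simp
    have "card ((\<lambda>j. j * 4 ^ (n - i)) ` {..<(4::nat) ^ i}) \<le> 4 ^ i"
      using card_image_le[of "{..<(4::nat) ^ i}"] by simp
    then have "card (rows i) \<le> (2 ^ (2 * n + m k - 2 * i) + 1) * 4 ^ i"
      by (simp add: rows_def card_cartesian_product del: mult_Suc)
    also have "\<dots> \<le> (2 * 2 ^ (2 * n + m k - 2 * i)) * 4 ^ i"
      by (intro mult_right_mono) auto
    also have "\<dots> = 2 * (2 ^ (2 * n + m k - 2 * i) * 2 ^ (2 * i))"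
      by (simp add: power_mult)
    also have "\<dots> = 2 * 2 ^ (2 * n + m k)" by (simp only: power_add[symmetric] i)
    finally show "card (rows i) \<le> 2 * 2 ^ (2 * n + m k)" .
  qed
  \<comment> \<open>The number of values of \<open>i\<close> is linear in \<open>n\<close> and is absorbed by a further factor \<open>2 ^ m k\<close>.\<close>
  also have "4 ^ n + (\<Sum>i\<le>n. 2 * 2 ^ (2 * n + m k)) \<le> (2 * n + 3) * (2::nat) ^ (33 * m k)"
  proof -
    have "(4::nat) ^ n = 2 ^ (2 * n)" by (simp add: power_mult)
    also have "\<dots> \<le> 2 ^ (33 * m k)" by (intro power_increasing) (auto simp: n_def)
    finally have "4 ^ n \<le> (2::nat) ^ (33 * m k)" .
    moreover have e: "2 * n + m k = 33 * m k" by (simp add: n_def)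
    have "(\<Sum>i\<le>n. 2 * 2 ^ (2 * n + m k)) = (2 * n + 2) * (2::nat) ^ (33 * m k)"
      unfolding e by simp
    ultimately show ?thesis by (simp add: add_mult_distrib)
  qed
  also have "(2 * n + 3) * (2::nat) ^ (33 * m k) \<le> (64 * 2 ^ m k) * 2 ^ (33 * m k)"
  proof (rule mult_right_mono)
    have "1 \<le> m k" by (simp add: m_def)
    with le_2_power[of "m k"] show "2 * n + 3 \<le> 64 * 2 ^ m k" unfolding n_def by linarith
  qed simp
  also have "\<dots> = 2 ^ (m k + 33 * m k + 6)" by (subst power_add, subst power_add) simp
  finally show ?thesis by (simp add: s_def n_def)
qed

text \<open>
  With \<open>M = 16 ^ k\<close> and \<open>n = 2 * M\<close>, the teeth of the family \<open>(k, n)\<close> have length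
  \<open>2 ^ -(3 * M) = 2 ^ M * 4 ^ -n\<close>. They contain at least \<open>2 ^ M * 4 ^ n = 2 ^ (5 * M)\<close> points of the grid of
  mesh \<open>4 ^ -n\<close>.
\<close>

lemma covering_number_comb_ge:
  defines "m k \<equiv> (16::nat) ^ k"
  shows "2 ^ (5 * m k) \<le> covering_number 2 (sqrt 2 / 4 ^ (2 * m k + 1)) (plane_vec ` closure comb)"
proof -
  define n where "n = 2 * m k"
  define g where "g = (\<lambda>(a, j). plane_vec (real a / 4 ^ n, real j / 4 ^ n))"
  define I where "I = {..<(2::nat) ^ m k} \<times> {..<(4::nat) ^ n}"
  \<comment> \<open>One step finer than the grid of points, so that the diagonal \<open>sqrt 2 * s\<close> of a square is less than
    the mesh.\<close>
  define s :: real where "s = 1 / 4 ^ (n + 1)"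
  have sep: "1 / 4 ^ n \<le> eucl_dist 2 (g u) (g v)" if "u \<noteq> v" for u v
  proof -
    obtain a b c d where uv: "u = (a, b)" "v = (c, d)" by fastforce
    have gap: "1 / 4 ^ n \<le> \<bar>real a / 4 ^ n - real b / 4 ^ n\<bar>" if "a \<noteq> b" for a b :: nat
    proof -
      have "1 \<le> \<bar>real a - real b\<bar>" using that by linarith
      then have "1 / 4 ^ n \<le> \<bar>real a - real b\<bar> / 4 ^ n" by (intro divide_right_mono) auto
      then show ?thesis by (simp add: diff_divide_distrib[symmetric])
    qed
    have "\<bar>x - x'\<bar> \<le> dist (x, y) (x', y')" "\<bar>y - y'\<bar> \<le> dist (x, y) (x', y')" for x y x' y' :: real
      using dist_fst_le[of "(x, y)" "(x', y')"] dist_snd_le[of "(x, y)" "(x', y')"]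
      by (simp_all add: dist_real_def)
    then show ?thesis
      using that gap[of a c] gap[of b d]
      by (auto simp: uv g_def eucl_dist_plane_vec intro: order_trans)
  qed
  have inj: "inj_on g I"
  proof (rule inj_onI, rule ccontr)
    fix u v assume "g u = g v" "u \<noteq> v"
    with sep[of u v] have "1 / 4 ^ n \<le> (0::real)"
      by (simp add: eucl_dist_def L2_set_def)
    moreover have "0 < 1 / (4::real) ^ n" by simp
    ultimately show False by linarith
  qed
  have sub: "g ` I \<subseteq> plane_vec ` closure comb"
  proof -
    have "(real a / 4 ^ n, real j / 4 ^ n) \<in> comb" if "a < 2 ^ m k" "j < 4 ^ n" for a j
    proof -
      have "real a \<le> 2 ^ m k"
        using that(1) by (metis less_imp_le of_nat_le_iff of_nat_numeral of_nat_power)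
      then have "real a / 4 ^ n \<le> 2 ^ m k / 4 ^ n" by (intro divide_right_mono) auto
      also have "\<dots> = 1 / 2 ^ (n + m k)"
      proof -
        have "(4::real) ^ n = 2 ^ (2 * n)" by (simp add: power_mult)
        also have "2 * n = m k + (n + m k)" by (simp add: n_def)
        finally have "(4::real) ^ n = 2 ^ m k * 2 ^ (n + m k)" by (simp only: power_add)
        then show ?thesis by simp
      qed
      finally have "(real a / 4 ^ n, real j / 4 ^ n) \<in> {0..1 / 2 ^ (n + 16 ^ k)} \<times> levels n"
        using that by (simp add: levels_def m_def)
      moreover have "n \<in> {..2 * 16 ^ k}" by (simp add: n_def m_def)
      ultimately show ?thesis unfolding comb_def by blast
    qed
    then show ?thesis using closure_subset[of comb] by (auto simp: g_def I_def)
  qed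
  \<comment> \<open>Some finite cover has to exist; all squares that meet the unit square will do.\<close>
  define N where "N = (4::nat) ^ (n + 1)"
  have "comb \<subseteq> (\<Union>ab\<in>{..N} \<times> {..N}. grid_square s ab)"
  proof
    fix z assume "z \<in> comb"
    then obtain x y where z: "z = (x, y)" "0 \<le> x" "x \<le> 1" "0 \<le> y" "y \<le> 1"
      using comb_in_square by force
    have s: "0 < s" by (simp add: s_def)
    obtain a :: nat where a: "real a \<le> x / s" "x \<in> {real a * s..(real a + 1) * s}"
      using grid_cell z s by metis
    obtain b :: nat where b: "real b \<le> y / s" "y \<in> {real b * s..(real b + 1) * s}"
      using grid_cell z s by metis
    have "x / s \<le> real N" "y / s \<le> real N" using z by (simp_all add: s_def N_def)
    then have "a \<le> N" "b \<le> N" using a b by linarith+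
    then show "z \<in> (\<Union>ab\<in>{..N} \<times> {..N}. grid_square s ab)"
      using a b by (auto simp: z grid_square_def)
  qed
  note cover = grid_square_cover[OF _ _ this]
  have "sqrt 2 * s < 1 / 4 ^ n"
    using sqrt2_less_2 by (simp add: s_def field_simps)
  then have "card (g ` I) \<le> covering_number 2 (sqrt 2 * s) (plane_vec ` closure comb)"
  proof (intro card_separated_le_covering_number[OF _ sub _ _ cover(1-3)])
    fix v w assume "v \<in> g ` I" "w \<in> g ` I" "v \<noteq> w"
    then show "sqrt 2 * s < eucl_dist 2 v w"
      using sep \<open>sqrt 2 * s < 1 / 4 ^ n\<close> by (metis imageE less_le_trans)
  qed (simp_all add: I_def s_def)
  moreover have "card (g ` I) = 2 ^ (5 * m k)"
  proof -
    have "(4::nat) ^ n = 2 ^ (2 * n)" by (simp add: power_mult)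
    moreover have "m k + 2 * n = 5 * m k" by (simp add: n_def)
    ultimately have "2 ^ m k * (4::nat) ^ n = 2 ^ (5 * m k)" by (simp only: flip: power_add)
    then show ?thesis by (simp add: card_image[OF inj, unfolded I_def] I_def card_cartesian_product)
  qed
  ultimately show ?thesis by (simp add: s_def n_def)
qed

section \<open>The two dimensions\<close>

lemma lower_box_dim_le:
  assumes "filterlim \<delta> (at_right 0) F" "F \<noteq> bot"
    and "\<forall>\<^sub>F k in F. ln (real (covering_number d (\<delta> k) E)) / - ln (\<delta> k) \<le> c"
  shows "lower_box_dim d E \<le> ereal c"
proof (rule ccontr)
  assume "\<not> ?thesis"
  then have "ereal c < lower_box_dim d E" by simp
  then have "\<forall>\<^sub>F \<delta> in at_right 0. ereal c < ereal (ln (real (covering_number d \<delta> E)) / - ln \<delta>)"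
    unfolding lower_box_dim_def by (rule less_LiminfD)
  then have "\<forall>\<^sub>F k in F. c < ln (real (covering_number d (\<delta> k) E)) / - ln (\<delta> k)"
    using assms(1) by (auto simp: filterlim_iff)
  with assms(3) have "\<forall>\<^sub>F k in F. False" by eventually_elim linarith
  with assms(2) show False by (simp add: eventually_False)
qed

lemma upper_box_dim_ge:
  assumes "filterlim \<delta> (at_right 0) F" "F \<noteq> bot"
    and "\<forall>\<^sub>F k in F. c \<le> ln (real (covering_number d (\<delta> k) E)) / - ln (\<delta> k)"
  shows "ereal c \<le> upper_box_dim d E"
proof (rule ccontr)
  assume "\<not> ?thesis"
  then have "upper_box_dim d E < ereal c" by simp
  then have "\<forall>\<^sub>F \<delta> in at_right 0. ereal (ln (real (covering_number d \<delta> E)) / - ln \<delta>) < ereal c"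
    unfolding upper_box_dim_def by (rule Limsup_lessD)
  then have "\<forall>\<^sub>F k in F. ln (real (covering_number d (\<delta> k) E)) / - ln (\<delta> k) < c"
    using assms(1) by (auto simp: filterlim_iff)
  with assms(3) have "\<forall>\<^sub>F k in F. False" by eventually_elim linarith
  with assms(2) show False by (simp add: eventually_False)
qed

lemma scale_tendsto_0:
  assumes "filterlim f at_top sequentially"
  shows "filterlim (\<lambda>k. sqrt 2 / 4 ^ f k) (at_right 0) sequentially"
proof -
  have "(\<lambda>n. sqrt 2 * (1 / 4) ^ n) \<longlonglongrightarrow> sqrt 2 * 0"
    by (intro tendsto_intros LIMSEQ_realpow_zero) auto
  then have "(\<lambda>n. sqrt 2 / 4 ^ n) \<longlonglongrightarrow> 0" by (simp add: power_divide)
  then have "(\<lambda>k. sqrt 2 / 4 ^ f k) \<longlonglongrightarrow> 0" using assms by (rule filterlim_compose)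
  then show ?thesis by (intro tendsto_imp_filterlim_at_right) auto
qed

lemma minus_ln_scale: "- ln (sqrt 2 / 4 ^ n) = (2 * real n - 1 / 2) * ln 2"
proof -
  have "(4::real) ^ n = 2 ^ (2 * n)" by (simp add: power_mult)
  then show ?thesis
    by (simp add: ln_div ln_sqrt ln_realpow algebra_simps)
qed

lemma lower_box_dim_comb: "lower_box_dim 2 (plane_vec ` closure comb) \<le> ereal (9 / 8)"
proof (rule lower_box_dim_le)
  have "filterlim (\<lambda>k. 16 * (16::nat) ^ k) at_top sequentially"
    by (rule filterlim_subseq) (simp add: strict_mono_def)
  then show "filterlim (\<lambda>k. sqrt 2 / 4 ^ (16 * 16 ^ k)) (at_right 0) sequentially"
    by (rule scale_tendsto_0)
  show "\<forall>\<^sub>F k in sequentially. ln (real (covering_number 2 (sqrt 2 / 4 ^ (16 * 16 ^ k))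
      (plane_vec ` closure comb))) / - ln (sqrt 2 / 4 ^ (16 * 16 ^ k)) \<le> 9 / 8"
    using eventually_ge_at_top[of 1]
  proof eventually_elim
    case (elim k)
    define m where "m = (16::nat) ^ k"
    define c where "c = covering_number 2 (sqrt 2 / 4 ^ (16 * m)) (plane_vec ` closure comb)"
    have "(16::nat) ^ 1 \<le> m" unfolding m_def using elim by (intro power_increasing) auto
    then have m: "16 \<le> real m" by simp
    have "c \<le> 2 ^ (34 * m + 6)"
      unfolding c_def m_def by (rule covering_number_comb_le)
    then have "real c \<le> 2 ^ (34 * m + 6)"
      by (metis of_nat_le_iff of_nat_numeral of_nat_power)
    then have "ln (real c) \<le> ln (2 ^ (34 * m + 6))"
      by (cases "c = 0") (simp, intro ln_mono, auto)
    also have "\<dots> = (34 * real m + 6) * ln 2" by (simp add: ln_realpow)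
    \<comment> \<open>This is where the choice of \<open>9 / 8\<close> enters: it holds once \<open>m \<ge> 4\<close>.\<close>
    also have "\<dots> \<le> (9 / 8 * (2 * real (16 * m) - 1 / 2)) * ln 2"
      using m by (intro mult_right_mono) auto
    finally have "ln (real c) \<le> 9 / 8 * - ln (sqrt 2 / 4 ^ (16 * m))"
      by (simp only: minus_ln_scale mult.assoc)
    moreover have "0 < - ln (sqrt 2 / 4 ^ (16 * m))"
      unfolding minus_ln_scale using m by (intro mult_pos_pos) auto
    ultimately have "ln (real c) / - ln (sqrt 2 / 4 ^ (16 * m)) \<le> 9 / 8"
      by (simp only: pos_divide_le_eq)
    then show ?case by (simp only: c_def m_def)
  qed
qed simp

lemma upper_box_dim_comb: "ereal (6 / 5) \<le> upper_box_dim 2 (plane_vec ` closure comb)"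
proof (rule upper_box_dim_ge)
  have "filterlim (\<lambda>k. 2 * (16::nat) ^ k + 1) at_top sequentially"
    by (rule filterlim_subseq) (simp add: strict_mono_def)
  then show "filterlim (\<lambda>k. sqrt 2 / 4 ^ (2 * 16 ^ k + 1)) (at_right 0) sequentially"
    by (rule scale_tendsto_0)
  show "\<forall>\<^sub>F k in sequentially. 6 / 5 \<le> ln (real (covering_number 2 (sqrt 2 / 4 ^ (2 * 16 ^ k + 1))
      (plane_vec ` closure comb))) / - ln (sqrt 2 / 4 ^ (2 * 16 ^ k + 1))"
    using eventually_ge_at_top[of 1]
  proof eventually_elim
    case (elim k)
    define m where "m = (16::nat) ^ k"
    define c where "c = covering_number 2 (sqrt 2 / 4 ^ (2 * m + 1)) (plane_vec ` closure comb)"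
    have "(16::nat) ^ 1 \<le> m" unfolding m_def using elim by (intro power_increasing) auto
    then have m: "16 \<le> real m" by simp
    have "2 ^ (5 * m) \<le> c"
      unfolding c_def m_def by (rule covering_number_comb_ge)
    then have c: "2 ^ (5 * m) \<le> real c"
      by (metis of_nat_le_iff of_nat_numeral of_nat_power)
    have "6 / 5 * - ln (sqrt 2 / 4 ^ (2 * m + 1)) = (6 / 5 * (2 * real (2 * m + 1) - 1 / 2)) * ln 2"
      by (simp only: minus_ln_scale mult.assoc)
    \<comment> \<open>This is where the choice of \<open>6 / 5\<close> enters: it holds once \<open>m \<ge> 9\<close>.\<close>
    also have "\<dots> \<le> (5 * real m) * ln 2"
      using m by (intro mult_right_mono) auto
    also have "\<dots> = ln (2 ^ (5 * m))" by (simp add: ln_realpow)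
    also have "\<dots> \<le> ln (real c)" using c by (intro ln_mono) auto
    finally have "6 / 5 * - ln (sqrt 2 / 4 ^ (2 * m + 1)) \<le> ln (real c)" .
    moreover have "0 < - ln (sqrt 2 / 4 ^ (2 * m + 1))"
      unfolding minus_ln_scale using m by (intro mult_pos_pos) auto
    ultimately have "6 / 5 \<le> ln (real c) / - ln (sqrt 2 / 4 ^ (2 * m + 1))"
      by (simp only: pos_le_divide_eq)
    then show ?case by (simp only: c_def m_def)
  qed
qed simp

theorem corollary1p4:
  shows "\<exists>(d::nat) (N::nat) (S :: nat \<Rightarrow> real vec \<Rightarrow> real vec) (E :: real vec set).
           1 \<le> d \<and> affine_IFS d N S \<and> sub_self_affine_set d N S E \<and>
           lower_box_dim d E < upper_box_dim d E"
proof (intro exI conjI)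
  show "affine_IFS 2 8 digit_IFS"
    by (simp add: affine_IFS_def digit_IFS_def affine_contraction_digit_map)
  show "sub_self_affine_set 2 8 digit_IFS (plane_vec ` closure comb)"
    by (rule sub_self_affine_comb)
  have "ereal (9 / 8) < ereal (6 / 5)" by simp
  then show "lower_box_dim 2 (plane_vec ` closure comb) < upper_box_dim 2 (plane_vec ` closure comb)"
    using lower_box_dim_comb upper_box_dim_comb by (meson le_less_trans less_le_trans)
qed simp

end
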